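(* Let $V$ be a valuation domain of rank one with quotient field $K$ and associated valuation $v$. Let $\beta\in\overline{K}$, where $\overline{K}$ is an algebraic closure of $K$, and let $u$ be an extension of $v$ to $\overline{K}$. Then the Zariski and the constructible topologies agree on $\mathcal{V}^u(\beta,\bullet)$.
   Context: $\mathrm{Zar}(K(X)|V)$ is the set of valuation domains of $K(X)$ (with quotient field $K(X)$) containing $V$. Its Zariski topology is generated by the subbasic open sets $B(\phi)=\{W\mid\phi\in W\}$, $\phi\in K(X)$; its constructible topology is the coarsest topology for which all sets $B(\phi_1)\cap\cdots\cap B(\phi_k)$ are both open and closed. Subsets carry the subspace topologies. A sequence $E=\{s_n\}_{n\in\mathbb{N}}$ in $K$ is pseudo-convergent if $v(s_{n+1}-s_n)<v(s_{n+2}-s_{n+1})$ for all $n$. $V_E=\{\phi\in K(X)\mid \phi(s_n)\in V\text{ for all but finitely many }n\in\mathbb{N}\}$ is a valuation domain of $K(X)$ with $V_E\cap K=V$. $\mathcal{L}_E^u$ is the set of the $\alpha\in\overline{K}$ such that $u(\alpha-s_n)<u(\alpha-s_{n+1})$ for all $n$ (the pseudo-limits of $E$ with respect to $u$). $\mathcal{V}^u(\beta,\bullet)$ is the set of rings $V_E$, with $E$ a pseudo-convergent sequence in $K$ such that $\beta\in\mathcal{L}_E^u$. *)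

theory Defs
  imports
    "HOL-Analysis.Abstract_Topology"
    "HOL-Library.Extended"
    "HOL-Library.Extended_Nat"
    "HOL-Algebra.Algebraic_Closure_Type"
begin

section \<open>Valuation domains and their rank\<close>

text \<open>The dichotomy forces the quotient field of \<open>V\<close> to be the whole field type.
  The trivial valuation domain \<open>UNIV\<close> is allowed.\<close>

definition valuation_domain :: "'a::field set \<Rightarrow> bool" where
  "valuation_domain V \<longleftrightarrow>
     0 \<in> V \<and> 1 \<in> V \<and>
     (\<forall>x\<in>V. \<forall>y\<in>V. x + y \<in> V \<and> x * y \<in> V) \<and> (\<forall>x\<in>V. - x \<in> V) \<and>
     (\<forall>x. x \<noteq> 0 \<longrightarrow> x \<in> V \<or> inverse x \<in> V)"

definition prime_ideal_in :: "'a::field set \<Rightarrow> 'a set \<Rightarrow> bool" where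
  "prime_ideal_in V P \<longleftrightarrow>
     P \<subseteq> V \<and> 0 \<in> P \<and> 1 \<notin> P \<and>
     (\<forall>x\<in>P. \<forall>y\<in>P. x + y \<in> P) \<and> (\<forall>r\<in>V. \<forall>x\<in>P. r * x \<in> P) \<and>
     (\<forall>x\<in>V. \<forall>y\<in>V. x * y \<in> P \<longrightarrow> x \<in> P \<or> y \<in> P)"

text \<open>The rank of a valuation domain is its Krull dimension.\<close>

definition valuation_rank :: "'a::field set \<Rightarrow> enat" where
  "valuation_rank V =
     Sup {enat n | n. \<exists>P :: nat \<Rightarrow> 'a set.
            (\<forall>i\<le>n. prime_ideal_in V (P i)) \<and> (\<forall>i<n. P i \<subset> P (Suc i))}"

section \<open>Valuations\<close>

text \<open>Values lie in an arbitrary linearly ordered abelian group with an element \<^term>\<open>Pinf\<close>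
  adjoined; the value \<^term>\<open>Minf\<close>, which the type also contains, is excluded. A valuation need
  not be surjective onto the group, so a valuation and an extension of it can share a type.\<close>

definition valuation :: "('a::field \<Rightarrow> 'g::linordered_ab_group_add extended) \<Rightarrow> bool" where
  "valuation w \<longleftrightarrow>
     (\<forall>x. w x \<noteq> Minf) \<and> (\<forall>x. w x = Pinf \<longleftrightarrow> x = 0) \<and>
     (\<forall>x y. w (x * y) = w x + w y) \<and> (\<forall>x y. min (w x) (w y) \<le> w (x + y))"

definition associated_valuation ::
    "'a::field set \<Rightarrow> ('a \<Rightarrow> 'g::linordered_ab_group_add extended) \<Rightarrow> bool" where
  "associated_valuation V v \<longleftrightarrow> valuation v \<and> V = {x. 0 \<le> v x}"

definition extends_valuation ::
    "('k::field alg_closure \<Rightarrow> 'g::linordered_ab_group_add extended) \<Rightarrow>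
     ('k \<Rightarrow> 'g extended) \<Rightarrow> bool" where
  "extends_valuation u v \<longleftrightarrow> valuation u \<and> (\<forall>x. u (to_ac x) = v x)"

section \<open>The Zariski space and its topologies\<close>

text \<open>\<open>K(X)\<close> is the type \<^typ>\<open>'k poly fract\<close>.\<close>

definition Zar :: "'k::field set \<Rightarrow> 'k poly fract set set" where
  "Zar V = {W. valuation_domain W \<and> (\<forall>a\<in>V. Fract [:a:] 1 \<in> W)}"

definition basic_open :: "'k::field set \<Rightarrow> 'k poly fract \<Rightarrow> 'k poly fract set set" where
  "basic_open V \<phi> = {W \<in> Zar V. \<phi> \<in> W}"

definition zariski_topology :: "'k::field set \<Rightarrow> 'k poly fract set topology" where
  "zariski_topology V = topology_generated_by (range (basic_open V))"

text \<open>The coarsest topology in which all finite intersections of the sets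
  \<^term>\<open>basic_open V \<phi>\<close> are clopen is generated by these intersections and their complements.\<close>

definition constructible_topology :: "'k::field set \<Rightarrow> 'k poly fract set topology" where
  "constructible_topology V =
     topology_generated_by
       (\<Union>\<Phi>\<in>{\<Phi>. finite \<Phi> \<and> \<Phi> \<noteq> {}}.
          {\<Inter>\<phi>\<in>\<Phi>. basic_open V \<phi>, Zar V - (\<Inter>\<phi>\<in>\<Phi>. basic_open V \<phi>)})"

section \<open>Pseudo-convergent sequences\<close>

definition pseudo_convergent ::
    "('k::field \<Rightarrow> 'g::linordered_ab_group_add extended) \<Rightarrow> (nat \<Rightarrow> 'k) \<Rightarrow> bool" where
  "pseudo_convergent v s \<longleftrightarrow>
     (\<forall>n. v (s (n + 1) - s n) < v (s (n + 2) - s (n + 1)))"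

text \<open>\<open>\<phi>\<close> is defined at \<open>x\<close> (that is, \<open>x\<close> is not a pole) and takes the value \<open>y\<close> there.\<close>

definition has_value_at :: "'k::field poly fract \<Rightarrow> 'k \<Rightarrow> 'k \<Rightarrow> bool" where
  "has_value_at \<phi> x y \<longleftrightarrow>
     (\<exists>p q. \<phi> = Fract p q \<and> poly q x \<noteq> 0 \<and> y = poly p x / poly q x)"

definition ring_of_sequence :: "'k::field set \<Rightarrow> (nat \<Rightarrow> 'k) \<Rightarrow> 'k poly fract set" where
  "ring_of_sequence V s =
     {\<phi>. \<exists>N. finite N \<and> (\<forall>n. n \<notin> N \<longrightarrow> (\<exists>y\<in>V. has_value_at \<phi> (s n) y))}"

definition pseudo_limits ::
    "('k::field alg_closure \<Rightarrow> 'g::linordered_ab_group_add extended) \<Rightarrow>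
     (nat \<Rightarrow> 'k) \<Rightarrow> 'k alg_closure set" where
  "pseudo_limits u s =
     {\<alpha>. \<forall>n. u (\<alpha> - to_ac (s n)) < u (\<alpha> - to_ac (s (n + 1)))}"

definition rings_with_pseudo_limit ::
    "'k::field set \<Rightarrow> ('k \<Rightarrow> 'g::linordered_ab_group_add extended) \<Rightarrow>
     ('k alg_closure \<Rightarrow> 'g extended) \<Rightarrow> 'k alg_closure \<Rightarrow> 'k poly fract set set" where
  "rings_with_pseudo_limit V v u \<beta> =
     {ring_of_sequence V s | s. pseudo_convergent v s \<and> \<beta> \<in> pseudo_limits u s}"

end

theory Submission
  imports Defs
begin

text \<open>It suffices to separate a ring \<open>V_E\<close> from a function \<open>\<phi> \<notin> V_E\<close> by a Zariski neighbourhood.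
  Along \<open>E\<close> the radii \<open>t = u (\<beta> - s_n)\<close> increase and \<open>\<phi>\<close> eventually has value
  \<open>\<gamma> + \<lambda> t\<close> with \<open>\<lambda>\<close> an integer. Either these negative values stay away from \<open>0\<close>, and then
  a single function \<open>e / \<phi>\<^sup>j\<close> with \<open>v e < 0\<close> separates, or \<open>\<lambda> > 0\<close> and they approach \<open>0\<close>. In that
  case the radii approach the value of an algebraic element \<open>g\<close>, and an interval of radii
  separates: its lower bound is imposed by \<open>(X - s_N) / (s_{N+1} - s_N)\<close>, its upper bound \<open>u g\<close>
  by \<open>e / h\<^sup>k\<close> for a polynomial \<open>h\<close> vanishing at \<open>\<beta>\<close>.\<close>

section \<open>Valuations\<close>

lemma valuation_zero [simp]: "valuation w \<Longrightarrow> w 0 = Pinf"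
  by (simp add: valuation_def)

lemma valuation_eq_Pinf_iff: "valuation w \<Longrightarrow> w x = Pinf \<longleftrightarrow> x = 0"
  by (simp add: valuation_def)

lemma valuation_mult: "valuation w \<Longrightarrow> w (x * y) = w x + w y"
  by (simp add: valuation_def)

lemma valuation_add: "valuation w \<Longrightarrow> min (w x) (w y) \<le> w (x + y)"
  by (simp add: valuation_def)

lemma valuation_nonzero_Fin:
  assumes "valuation w" "x \<noteq> 0"
  obtains a where "w x = Fin a"
  using assms by (cases "w x") (auto simp: valuation_def)

lemma valuation_one [simp]:
  assumes "valuation w"
  shows "w 1 = 0"
proof -
  obtain a where a: "w 1 = Fin a"
    using valuation_nonzero_Fin[OF assms one_neq_zero] .
  have "w (1 * 1) = w 1 + w 1"
    using assms by (rule valuation_mult)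
  then show ?thesis
    using a by (simp add: zero_extended_def)
qed

lemma valuation_minus:
  assumes "valuation w"
  shows "w (- x) = w x"
proof -
  obtain a where a: "w (- 1) = Fin a"
    using valuation_nonzero_Fin[OF assms] by (metis neg_equal_0_iff_equal one_neq_zero)
  have "w (- 1 * - 1) = w (- 1) + w (- 1)"
    using assms by (rule valuation_mult)
  then have "a + a = 0"
    using a assms by (simp add: zero_extended_def)
  then have "w (- 1) = 0"
    using a by (simp add: zero_extended_def)
  then show ?thesis
    using valuation_mult[OF assms, of "- 1" x] by simp
qed

lemma valuation_minus_commute:
  assumes "valuation w"
  shows "w (x - y) = w (y - x)"
  using valuation_minus[OF assms, of "x - y"] by simp

section \<open>Monotonicity and cancellation for products, powers and quotients\<close>

lemma valuation_mult_left_mono: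
  assumes "valuation w" "w x \<le> w y"
  shows "w (z * x) \<le> w (z * y)"
  using assms by (simp add: valuation_mult add_left_mono)

lemma valuation_mult_left_strict_mono:
  assumes "valuation w" "w x < w y" "z \<noteq> 0"
  shows "w (z * x) < w (z * y)"
proof -
  obtain a where "w z = Fin a"
    using valuation_nonzero_Fin[OF assms(1,3)] .
  then show ?thesis
    using assms(1,2) by (cases "w x"; cases "w y") (simp_all add: valuation_mult)
qed

lemma valuation_mult_less_cancel:
  assumes "valuation w" "z \<noteq> 0"
  shows "w (z * x) < w (z * y) \<longleftrightarrow> w x < w y"
  using valuation_mult_left_strict_mono[OF assms(1) _ assms(2)]
    valuation_mult_left_mono[OF assms(1)] by (meson leD leI)

lemma valuation_mult_le_cancel:
  assumes "valuation w" "z \<noteq> 0"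
  shows "w (z * x) \<le> w (z * y) \<longleftrightarrow> w x \<le> w y"
  using valuation_mult_less_cancel[OF assms, of y x] by (simp add: not_less[symmetric])

lemma valuation_mult_mono:
  assumes "valuation w" "w x \<le> w y" "w x' \<le> w y'"
  shows "w (x * x') \<le> w (y * y')"
  using assms by (simp add: valuation_mult add_mono)

lemma valuation_mult_strict_mono:
  assumes "valuation w" "w x < w y" "w x' \<le> w y'" "x' \<noteq> 0"
  shows "w (x * x') < w (y * y')"
proof -
  have "w (x' * x) < w (x' * y)"
    using assms by (simp add: valuation_mult_less_cancel)
  also have "\<dots> \<le> w (y' * y)"
    by (rule valuation_mult_mono[OF assms(1,3) order_refl])
  finally show ?thesis
    by (simp add: mult.commute)
qed

lemma valuation_power_mono:
  assumes "valuation w" "w x \<le> w y"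
  shows "w (x ^ n) \<le> w (y ^ n)"
  by (induction n) (simp_all add: valuation_mult_mono[OF assms])

lemma valuation_power_strict_mono:
  assumes "valuation w" "w x < w y" "n > 0"
  shows "w (x ^ n) < w (y ^ n)"
proof -
  have "x \<noteq> 0"
    using assms by auto
  obtain m where "n = Suc m"
    using assms(3) gr0_implies_Suc by blast
  moreover have "w (x * x ^ m) < w (y * y ^ m)"
    by (rule valuation_mult_strict_mono[OF assms(1,2)
          valuation_power_mono[OF assms(1) less_imp_le[OF assms(2)]]])
      (use \<open>x \<noteq> 0\<close> in simp)
  ultimately show ?thesis
    by simp
qed

lemma valuation_power_less_cancel:
  assumes "valuation w" "n > 0"
  shows "w (x ^ n) < w (y ^ n) \<longleftrightarrow> w x < w y"
  using valuation_power_strict_mono[OF assms(1) _ assms(2)]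
    valuation_power_mono[OF assms(1)] by (meson leD leI)

lemma valuation_divide_le_iff:
  assumes "valuation w" "z \<noteq> 0"
  shows "w (x / z) \<le> w (y / z) \<longleftrightarrow> w x \<le> w y"
  using valuation_mult_le_cancel[OF assms, of "x / z" "y / z"] assms(2) by simp

lemma valuation_nonneg_divide_iff:
  assumes "valuation w" "y \<noteq> 0"
  shows "0 \<le> w (x / y) \<longleftrightarrow> w y \<le> w x"
  using valuation_divide_le_iff[OF assms, of y x] assms by simp

section \<open>The ultrametric inequality and its equality case\<close>

lemma valuation_add_eq:
  assumes "valuation w" "w x < w y"
  shows "w (x + y) = w x"
proof (rule antisym)
  show "w x \<le> w (x + y)"
    using valuation_add[OF assms(1), of x y] assms(2) by (simp add: min_absorb1 less_imp_le)
  show "w (x + y) \<le> w x"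
    using valuation_add[OF assms(1), of "x + y" "- y"] assms
    by (auto simp: valuation_minus min_def split: if_splits)
qed

lemma valuation_diff_eq_left:
  assumes "valuation w" "w x < w y"
  shows "w (x - y) = w x"
  using valuation_add_eq[of w x "- y"] assms by (simp add: valuation_minus)

lemma valuation_diff_eq_right:
  assumes "valuation w" "w y < w x"
  shows "w (x - y) = w y"
  using valuation_diff_eq_left[OF assms] valuation_minus_commute[OF assms(1)] by metis

lemma valuation_diff:
  assumes "valuation w"
  shows "min (w x) (w y) \<le> w (x - y)"
  using valuation_add[OF assms, of x "- y"] assms by (simp add: valuation_minus)

text \<open>Summands are added one at a time: the new value differs from that of the partial sum, so
  the smaller of the two survives. Membership in the set of values is all that is recorded, which is
  enough to see that the sum cannot vanish.\<close>

lemma valuation_sum_distinct_values: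
  assumes "valuation w" "finite I" "I \<noteq> {}" "\<And>i. i \<in> I \<Longrightarrow> f i \<noteq> 0" "inj_on (w \<circ> f) I"
  shows "w (sum f I) \<in> (w \<circ> f) ` I"
  using assms(2-)
proof (induction rule: finite_ne_induct)
  case (insert i I)
  then have IH: "w (sum f I) \<in> (w \<circ> f) ` I"
    by auto
  with insert have "w (f i) \<noteq> w (sum f I)"
    by (auto simp: inj_on_def)
  then have "w (f i + sum f I) \<in> {w (f i), w (sum f I)}"
    using valuation_add_eq[OF assms(1), of "f i" "sum f I"]
      valuation_add_eq[OF assms(1), of "sum f I" "f i"]
    by (auto simp: neq_iff add.commute)
  then show ?case
    using insert.hyps IH by auto
qed auto


section \<open>Extending a valuation to the algebraic closure\<close>

lemma poly_map_poly_to_ac: "poly (map_poly to_ac p) (to_ac x) = to_ac (poly p x)"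
  by (induction p) (simp_all add: map_poly_pCons)

lemma map_poly_to_ac_eq_0_iff [simp]: "map_poly to_ac p = 0 \<longleftrightarrow> p = 0"
  by (rule map_poly_eq_0_iff) auto

text \<open>Among the terms of a polynomial relation for \<open>\<alpha>\<close> over the base field, two must have
  the same value, since otherwise the sum could not vanish.\<close>

lemma extension_value_torsion:
  fixes u :: "'k::field alg_closure \<Rightarrow> 'g::linordered_ab_group_add extended"
  assumes "valuation u" "\<alpha> \<noteq> 0"
  obtains k e where "k > 0" "e \<noteq> 0" "u (\<alpha> ^ k) = u (to_ac e)"
proof -
  obtain p :: "'k poly" where p: "p \<noteq> 0" "poly (map_poly to_ac p) \<alpha> = 0"
    using alg_closure_algebraic[of \<alpha>] .
  define I where "I = {i. i \<le> degree p \<and> coeff p i \<noteq> 0}"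
  define f where "f i = to_ac (coeff p i) * \<alpha> ^ i" for i
  have fin: "finite I" and ne: "I \<noteq> {}"
    using p(1) unfolding I_def by (auto intro!: exI[of _ "degree p"])
  have f0: "f i \<noteq> 0" if "i \<in> I" for i
    using that assms(2) by (auto simp: I_def f_def)
  have "degree (map_poly (to_ac :: 'k \<Rightarrow> _) p) = degree p"
    by (rule degree_map_poly) auto
  then have "(\<Sum>i\<le>degree p. f i) = 0"
    using p(2) by (simp add: poly_altdef coeff_map_poly f_def)
  also have "(\<Sum>i\<le>degree p. f i) = sum f I"
    by (rule sum.mono_neutral_right) (auto simp: I_def f_def)
  finally have sum0: "sum f I = 0" .
  have "\<not> inj_on (u \<circ> f) I"
  proof
    assume "inj_on (u \<circ> f) I"
    then have "u (sum f I) \<in> (u \<circ> f) ` I"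
      using valuation_sum_distinct_values[OF assms(1) fin ne] f0 by blast
    then obtain i where i: "i \<in> I" "u (f i) = Pinf"
      using sum0 assms(1) by auto
    then show False
      using f0[OF i(1)] assms(1) by (simp add: valuation_eq_Pinf_iff)
  qed
  then obtain a b where "a \<in> I" "b \<in> I" "u (f a) = u (f b)" "a \<noteq> b"
    by (auto simp: inj_on_def)
  then obtain i j where ij: "i \<in> I" "j \<in> I" "u (f i) = u (f j)" "i < j"
    by (cases a b rule: linorder_cases) auto
  \<comment> \<open>This factor cancels the coefficient of \<open>f j\<close> and the power of
    \<open>\<alpha>\<close> in \<open>f i\<close>, leaving a quotient of coefficients on one side
    and a pure power of \<open>\<alpha>\<close> on the other.\<close>
  define z where "z = inverse (to_ac (coeff p j) * \<alpha> ^ i)"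
  have "z * f i = to_ac (coeff p i / coeff p j)" "z * f j = \<alpha> ^ (j - i)"
    using ij assms(2) by (auto simp: z_def f_def I_def field_simps power_add[symmetric])
  moreover have "u (z * f i) = u (z * f j)"
    using ij assms(1) by (simp add: valuation_mult)
  ultimately have "u (\<alpha> ^ (j - i)) = u (to_ac (coeff p i / coeff p j))"
    by simp
  then show thesis
    using ij by (intro that[of "j - i" "coeff p i / coeff p j"]) (auto simp: I_def)
qed

lemma poly_root_multiset:
  fixes P :: "'a::alg_closed_field poly"
  assumes "P \<noteq> 0"
  obtains c A where "c \<noteq> 0" "\<And>x. poly P x = c * (\<Prod>a\<in>#A. x - a)"
proof -
  obtain A where A: "P = smult (lead_coeff P) (\<Prod>a\<in>#A. [:-a, 1:])"
    using alg_closed_imp_factorization[OF assms] by blast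
  have "poly P x = lead_coeff P * (\<Prod>a\<in>#A. x - a)" for x
  proof -
    have "poly P x = lead_coeff P * poly (\<Prod>a\<in>#A. [:-a, 1:]) x"
      by (subst A) simp
    also have "poly (\<Prod>a\<in>#A. [:-a, 1:]) x = (\<Prod>a\<in>#A. x - a)"
      by (induction A) (auto simp: algebra_simps)
    finally show ?thesis .
  qed
  then show thesis
    using that[of "lead_coeff P" A] assms by simp
qed


section \<open>Radii around a pseudo-limit\<close>

text \<open>Used with the algebraic closure as field and the images of the members of a sequence as
  \<open>z\<close>. The radius of \<open>x\<close> is \<open>u (\<beta> - x)\<close>; a larger
  radius means that \<open>x\<close> is closer to \<open>\<beta>\<close>.\<close>

locale pseudo_limit_sequence =
  fixes u :: "'a::field \<Rightarrow> 'g::linordered_ab_group_add extended"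
    and \<beta> :: 'a and z :: "nat \<Rightarrow> 'a"
  assumes valuation_u: "valuation u"
    and radius_less_Suc: "u (\<beta> - z n) < u (\<beta> - z (Suc n))"
begin

section \<open>Growth of the radii\<close>

lemma radius_strict_mono: "strict_mono (\<lambda>n. u (\<beta> - z n))"
  using radius_less_Suc by (simp add: strict_mono_Suc_iff)

lemma radius_less_iff: "u (\<beta> - z m) < u (\<beta> - z n) \<longleftrightarrow> m < n"
  using strict_mono_less[OF radius_strict_mono] .

lemma radius_le_iff: "u (\<beta> - z m) \<le> u (\<beta> - z n) \<longleftrightarrow> m \<le> n"
  using strict_mono_less_eq[OF radius_strict_mono] .

lemma inj_z: "inj z"
  by (rule injI) (metis radius_less_iff linorder_neqE_nat less_irrefl)

lemma z_neq_limit: "\<beta> \<noteq> z n"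
  using radius_less_Suc[of n] valuation_u by auto

text \<open>Realises a radius as the value of a difference of members, which lies in the base field
  when the members do.\<close>

lemma value_diff_z: "m < n \<Longrightarrow> u (z n - z m) = u (\<beta> - z m)"
  using valuation_diff_eq_left[OF valuation_u, of "\<beta> - z m" "\<beta> - z n"]
  by (simp add: radius_less_iff)

lemma radius_less_if_bounded:
  assumes "\<And>n. u (\<beta> - z n) \<le> u g"
  shows "u (\<beta> - z n) < u g"
  using radius_less_Suc[of n] assms[of "Suc n"] by (rule less_le_trans)

text \<open>The radii are pairwise distinct, so each value is taken at most once. This serves to
  avoid the radii of roots, at which the value of a difference is not controlled.\<close>

lemma eventually_radius_notin:
  assumes "finite F"
  shows "\<forall>\<^sub>F n in sequentially. u (\<beta> - z n) \<notin> F"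
proof -
  have "finite ((\<lambda>n. u (\<beta> - z n)) -` F)"
    using assms strict_mono_imp_inj_on[OF radius_strict_mono] by (intro finite_vimageI)
  then show ?thesis
    unfolding cofinite_eq_sequentially[symmetric] eventually_cofinite by (simp add: vimage_def)
qed

text \<open>The upper bound on the radius is the cut defined by all radii of the sequence rather
  than a single value, since these radii need not have a supremum in the value group.\<close>

definition annulus :: "nat \<Rightarrow> 'a set" where
  "annulus N = {x. u (\<beta> - z N) < u (\<beta> - x) \<and> (\<exists>m. u (\<beta> - x) < u (\<beta> - z m))}"

lemma annulus_antimono: "M \<le> N \<Longrightarrow> annulus N \<subseteq> annulus M"
  using radius_le_iff[of M N] by (auto simp: annulus_def)

lemma z_in_annulus: "N < n \<Longrightarrow> z n \<in> annulus N"
  by (auto simp: annulus_def radius_less_iff)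

text \<open>If some radius reaches \<open>u (\<beta> - \<alpha>)\<close>, then beyond it
  \<open>x\<close> is closer to \<open>\<beta>\<close> than \<open>\<alpha>\<close> is, and the
  value is constant (\<open>k = 0\<close>). Otherwise every point of the annulus is farther from
  \<open>\<beta>\<close> than \<open>\<alpha>\<close> is, and the value is its radius
  (\<open>k = 1\<close>).\<close>

lemma linear_value_on_annulus:
  "\<exists>N c k. c \<noteq> 0 \<and> (\<forall>x\<in>annulus N. u (x - \<alpha>) = u (c * (\<beta> - x) ^ k))"
proof (cases "\<exists>n. u (\<beta> - \<alpha>) \<le> u (\<beta> - z n)")
  case True
  then obtain n where n: "u (\<beta> - \<alpha>) \<le> u (\<beta> - z n)"
    by blast
  have "u (x - \<alpha>) = u ((\<beta> - \<alpha>) * (\<beta> - x) ^ 0)" if "x \<in> annulus n" for x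
  proof -
    have "u (\<beta> - \<alpha>) < u (\<beta> - x)"
      using that n by (auto simp: annulus_def)
    from valuation_diff_eq_left[OF valuation_u this] show ?thesis
      by simp
  qed
  moreover have "\<beta> - \<alpha> \<noteq> 0"
    using n z_neq_limit[of n] valuation_eq_Pinf_iff[OF valuation_u, of "\<beta> - z n"] valuation_u
    by auto
  ultimately show ?thesis
    by blast
next
  case False
  have "u (x - \<alpha>) = u (1 * (\<beta> - x) ^ 1)" if x: "x \<in> annulus 0" for x
  proof -
    obtain m where "u (\<beta> - x) < u (\<beta> - z m)"
      using x by (auto simp: annulus_def)
    also have "\<dots> < u (\<beta> - \<alpha>)"
      using False by (auto simp: not_le)
    finally have "u (\<beta> - x) < u (\<beta> - \<alpha>)" .
    from valuation_diff_eq_right[OF valuation_u this] show ?thesis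
      by simp
  qed
  then show ?thesis
    by (metis one_neq_zero)
qed

text \<open>Constants multiply and exponents add over the factors; the annulus with the larger index
  lies in both annuli.\<close>

lemma prod_mset_value_on_annulus:
  "\<exists>N c k. c \<noteq> 0 \<and> (\<forall>x\<in>annulus N. u (\<Prod>a\<in>#A. x - a) = u (c * (\<beta> - x) ^ k))"
proof (induction A)
  case empty
  have "\<forall>x\<in>annulus 0. u (\<Prod>a\<in>#{#}. x - a) = u (1 * (\<beta> - x) ^ 0)"
    by simp
  then show ?case
    by (metis one_neq_zero)
next
  case (add b A)
  then obtain N c k where 1: "c \<noteq> 0"
    "\<And>x. x \<in> annulus N \<Longrightarrow> u (\<Prod>a\<in>#A. x - a) = u (c * (\<beta> - x) ^ k)"
    by blast
  obtain M d l where 2: "d \<noteq> 0" "\<And>x. x \<in> annulus M \<Longrightarrow> u (x - b) = u (d * (\<beta> - x) ^ l)"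
    using linear_value_on_annulus[of b] by blast
  have "u (\<Prod>a\<in>#add_mset b A. x - a) = u ((d * c) * (\<beta> - x) ^ (l + k))"
    if "x \<in> annulus (max N M)" for x
  proof -
    have x: "x \<in> annulus N" "x \<in> annulus M"
      using that annulus_antimono[of N "max N M"] annulus_antimono[of M "max N M"] by auto
    have "u (\<Prod>a\<in>#add_mset b A. x - a) = u (x - b) + u (\<Prod>a\<in>#A. x - a)"
      by (simp add: valuation_mult[OF valuation_u])
    also have "\<dots> = u ((d * (\<beta> - x) ^ l) * (c * (\<beta> - x) ^ k))"
      using 1(2)[OF x(1)] 2(2)[OF x(2)] by (simp only: valuation_mult[OF valuation_u])
    finally show ?thesis
      by (simp add: power_add mult_ac)
  qed
  then show ?case
    using 1(1) 2(1) by (intro exI[of _ "max N M"] exI[of _ "d * c"] exI[of _ "l + k"]) auto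
qed

lemma radius_ge_eventually_greater:
  assumes "\<forall>\<^sub>F n in sequentially. r \<le> u (\<beta> - z n)"
  shows "\<forall>\<^sub>F n in sequentially. r < u (\<beta> - z n)"
proof -
  obtain n where n: "r \<le> u (\<beta> - z n)"
    using eventually_happens[OF assms] by auto
  have "r < u (\<beta> - z m)" if "m > n" for m
    using n radius_less_iff[of n m] that by (meson le_less_trans)
  then show ?thesis
    using eventually_gt_at_top[of n] by (rule eventually_mono[rotated])
qed

lemma poly_value_on_annulus:
  assumes splits: "\<And>x. poly P x = c * (\<Prod>a\<in>#A. x - a)" and "c \<noteq> 0"
  obtains N d k where "d \<noteq> 0" "\<And>x. x \<in> annulus N \<Longrightarrow> u (poly P x) = u (d * (\<beta> - x) ^ k)"
proof -
  obtain N d k where d: "d \<noteq> 0" "\<And>x. x \<in> annulus N \<Longrightarrow> u (\<Prod>a\<in>#A. x - a) = u (d * (\<beta> - x) ^ k)"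
    using prod_mset_value_on_annulus[of A] by blast
  have "u (poly P x) = u ((c * d) * (\<beta> - x) ^ k)" if "x \<in> annulus N" for x
    using d(2)[OF that] by (simp add: splits valuation_mult[OF valuation_u] mult.assoc)
  then show thesis
    using that[of "c * d" N k] d(1) assms(2) by simp
qed

end


section \<open>A polynomial detecting a radius\<close>

text \<open>\<open>cut_off u \<beta> g a\<close> has value \<open>min (u (\<beta> - a)) (u g)\<close>, which is the value
  of \<open>x - a\<close> at a generic point \<open>x\<close> of radius \<open>u g\<close> around \<open>\<beta>\<close>.\<close>

definition cut_off :: "('a::field \<Rightarrow> 'g::linorder) \<Rightarrow> 'a \<Rightarrow> 'a \<Rightarrow> 'a \<Rightarrow> 'a" where
  "cut_off u \<beta> g a = (if u (\<beta> - a) < u g then \<beta> - a else g)"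

lemma cut_off_nonzero:
  assumes "valuation u" "g \<noteq> 0"
  shows "cut_off u \<beta> g a \<noteq> 0"
  using assms by (auto simp: cut_off_def)

lemma prod_cut_off_nonzero:
  assumes "valuation u" "g \<noteq> 0"
  shows "(\<Prod>a\<in>#A. cut_off u \<beta> g a) \<noteq> 0"
  using cut_off_nonzero[OF assms] by (induction A) auto

text \<open>For \<open>a\<close> of radius below \<open>u g\<close> both sides equal that radius;
  otherwise \<open>x\<close> and \<open>a\<close> both have radius at least \<open>u g\<close>, and
  the ultrametric inequality applies.\<close>

lemma cut_off_le:
  assumes "valuation u" "u g < u (\<beta> - x)"
  shows "u (cut_off u \<beta> g a) \<le> u (x - a)"
proof (cases "u (\<beta> - a) < u g")
  case True
  then have "u (\<beta> - a) < u (\<beta> - x)"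
    using assms(2) by (rule less_trans)
  from valuation_diff_eq_left[OF assms(1) this] show ?thesis
    using True by (simp add: cut_off_def)
next
  case False
  then have "u g \<le> min (u (\<beta> - a)) (u (\<beta> - x))"
    using assms(2) by (simp add: not_less less_imp_le)
  also have "\<dots> \<le> u (x - a)"
    using valuation_diff[OF assms(1), of "\<beta> - a" "\<beta> - x"] by simp
  finally show ?thesis
    using False by (simp add: cut_off_def)
qed

text \<open>Distinct radii make \<open>u (x - a)\<close> the smaller of the two. For equal radii,
  \<open>x - a\<close> could have a larger value.\<close>

lemma cut_off_ge:
  assumes "valuation u" "u (\<beta> - x) \<le> u g" "u (\<beta> - x) \<noteq> u (\<beta> - a)"
  shows "u (x - a) \<le> u (cut_off u \<beta> g a)"
proof (cases "u (\<beta> - a) < u (\<beta> - x)")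
  case True
  then have "u (\<beta> - a) < u g"
    using assms(2) by (rule less_le_trans)
  with valuation_diff_eq_left[OF assms(1) True] show ?thesis
    by (simp add: cut_off_def)
next
  case False
  then have "u (\<beta> - x) < u (\<beta> - a)"
    using assms(3) by simp
  with valuation_diff_eq_right[OF assms(1) this] assms(2) show ?thesis
    by (simp add: cut_off_def less_imp_le)
qed

lemma prod_cut_off_le:
  assumes "valuation u" "u g < u (\<beta> - x)"
  shows "u (\<Prod>a\<in>#A. cut_off u \<beta> g a) \<le> u (\<Prod>a\<in>#A. x - a)"
  by (induction A) (simp_all add: valuation_mult_mono[OF assms(1) cut_off_le[OF assms]])

text \<open>Strictness comes from one factor with \<open>a = \<beta>\<close>, whose cut-off is
  \<open>g\<close> itself; the other factors contribute the weak bound.\<close>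

lemma prod_cut_off_less:
  assumes "valuation u" "u g < u (\<beta> - x)" "g \<noteq> 0" "\<beta> \<in># A"
  shows "u (\<Prod>a\<in>#A. cut_off u \<beta> g a) < u (\<Prod>a\<in>#A. x - a)"
proof -
  obtain B where B: "A = add_mset \<beta> B"
    using multi_member_split[OF assms(4)] by blast
  have "cut_off u \<beta> g \<beta> = g"
    using assms(1) by (simp add: cut_off_def)
  then have "u (cut_off u \<beta> g \<beta>) < u (x - \<beta>)"
    using assms(1,2) by (simp add: valuation_minus_commute[of u x])
  from valuation_mult_strict_mono[OF assms(1) this prod_cut_off_le[OF assms(1,2)]
      prod_cut_off_nonzero[OF assms(1,3)]]
  show ?thesis
    by (simp add: B)
qed

lemma prod_cut_off_ge:
  assumes "valuation u" "u (\<beta> - x) \<le> u g" "\<And>a. a \<in># A \<Longrightarrow> u (\<beta> - x) \<noteq> u (\<beta> - a)"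
  shows "u (\<Prod>a\<in>#A. x - a) \<le> u (\<Prod>a\<in>#A. cut_off u \<beta> g a)"
  using assms(3)
  by (induction A) (simp_all add: valuation_mult_mono[OF assms(1) cut_off_ge[OF assms(1,2)]])

text \<open>A polynomial vanishing at \<open>\<beta>\<close> has strictly increasing value as the radius around
  \<open>\<beta>\<close> grows, because each root contributes the minimum of the radius and a constant and the
  root \<open>\<beta>\<close> contributes the radius itself. A power makes the critical value attained in
  the base field.\<close>

lemma radius_detecting_poly:
  fixes u :: "'k::field alg_closure \<Rightarrow> 'g::linordered_ab_group_add extended"
  assumes val: "valuation u" and g: "g \<noteq> 0"
  obtains H :: "'k poly" and e :: 'k and F where "H \<noteq> 0" "finite F"
    "\<And>x. u g < u (\<beta> - to_ac x) \<Longrightarrow> u (to_ac e) < u (to_ac (poly H x))"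
    "\<And>x. u (\<beta> - to_ac x) \<le> u g \<Longrightarrow> u (\<beta> - to_ac x) \<notin> F \<Longrightarrow>
       u (to_ac (poly H x)) \<le> u (to_ac e)"
proof -
  obtain h :: "'k poly" where h: "h \<noteq> 0" "poly (map_poly to_ac h) \<beta> = 0"
    using alg_closure_algebraic[of \<beta>] .
  obtain c A where c: "c \<noteq> 0" and A: "\<And>x. poly (map_poly to_ac h) x = c * (\<Prod>a\<in>#A. x - a)"
    using poly_root_multiset[of "map_poly to_ac h"] h(1) by auto
  have "\<beta> \<in># A"
    using h(2) c by (auto simp: A)
  define G where "G = c * (\<Prod>a\<in>#A. cut_off u \<beta> g a)"
  have "G \<noteq> 0"
    using c prod_cut_off_nonzero[OF val g] by (simp add: G_def)
  then obtain k e where k: "k > 0" and e: "u (G ^ k) = u (to_ac e)"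
    using extension_value_torsion[OF val] by blast
  have value_h: "to_ac (poly (h ^ k) x) = (c * (\<Prod>a\<in>#A. to_ac x - a)) ^ k" for x
    using A[of "to_ac x"] by (simp add: poly_map_poly_to_ac)
  show thesis
  \<comment> \<open>The exceptional set consists of the radii of the roots of \<open>h\<close>, as
    \<open>prod_cut_off_ge\<close> requires.\<close>
  proof (rule that[of "h ^ k" "(\<lambda>a. u (\<beta> - a)) ` set_mset A" e])
    show "u (to_ac e) < u (to_ac (poly (h ^ k) x))" if "u g < u (\<beta> - to_ac x)" for x
      unfolding e[symmetric] value_h G_def
      by (rule valuation_power_strict_mono[OF val valuation_mult_left_strict_mono[OF val
              prod_cut_off_less[OF val that g \<open>\<beta> \<in># A\<close>] c] k])
    show "u (to_ac (poly (h ^ k) x)) \<le> u (to_ac e)"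
      if "u (\<beta> - to_ac x) \<le> u g" "u (\<beta> - to_ac x) \<notin> (\<lambda>a. u (\<beta> - a)) ` set_mset A" for x
      unfolding e[symmetric] value_h G_def
      by (rule valuation_power_mono[OF val valuation_mult_left_mono[OF val
              prod_cut_off_ge[OF val that(1)]]]) (use that(2) in auto)
  qed (use h(1) in auto)
qed


section \<open>Separating a ring from a rational function outside it\<close>

text \<open>By cross-multiplication, any two representatives whose denominators do not vanish at
  \<open>x\<close> give the same value there.\<close>

lemma has_value_at_Fract_iff:
  assumes "poly q x \<noteq> 0"
  shows "has_value_at (Fract p q) x y \<longleftrightarrow> y = poly p x / poly q x"
proof
  assume "has_value_at (Fract p q) x y"
  then obtain p' q' where *: "Fract p q = Fract p' q'" "poly q' x \<noteq> 0" "y = poly p' x / poly q' x"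
    by (auto simp: has_value_at_def)
  have "q \<noteq> 0" "q' \<noteq> 0"
    using assms *(2) by auto
  then have "p * q' = p' * q"
    using *(1) by (simp add: eq_fract)
  then have "poly p x * poly q' x = poly p' x * poly q x"
    by (metis poly_mult)
  then show "y = poly p x / poly q x"
    using assms *(2,3) by (simp add: frac_eq_eq)
qed (use assms in \<open>auto simp: has_value_at_def\<close>)

lemma eventually_poly_nonzero:
  fixes s :: "nat \<Rightarrow> 'a::field"
  assumes "inj s" "q \<noteq> 0"
  shows "\<forall>\<^sub>F n in sequentially. poly q (s n) \<noteq> 0"
proof -
  have "finite (s -` {x. poly q x = 0})"
    using assms by (intro finite_vimageI poly_roots_finite)
  then show ?thesis
    unfolding cofinite_eq_sequentially[symmetric] eventually_cofinite by (simp add: vimage_def)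
qed

text \<open>By injectivity the denominator vanishes at only finitely many members, and elsewhere
  membership of the quotient in \<open>V\<close> is a comparison of values.\<close>

lemma Fract_in_ring_of_sequence_iff:
  assumes "associated_valuation V v" "inj s" "q \<noteq> 0"
  shows "Fract p q \<in> ring_of_sequence V s \<longleftrightarrow>
    (\<forall>\<^sub>F n in sequentially. v (poly q (s n)) \<le> v (poly p (s n)))"
proof -
  have val: "valuation v" and V: "\<And>x. x \<in> V \<longleftrightarrow> 0 \<le> v x"
    using assms(1) by (auto simp: associated_valuation_def)
  \<comment> \<open>The smallest admissible exceptional set is the set of failures, which leads to
    the cofinite filter.\<close>
  have "(\<exists>N. finite N \<and> (\<forall>n. n \<notin> N \<longrightarrow> P n)) \<longleftrightarrow> finite {n. \<not> P n}" for P :: "nat \<Rightarrow> bool"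
    by (auto intro: rev_finite_subset)
  then have "Fract p q \<in> ring_of_sequence V s \<longleftrightarrow>
      (\<forall>\<^sub>F n in sequentially. \<exists>y\<in>V. has_value_at (Fract p q) (s n) y)"
    unfolding ring_of_sequence_def cofinite_eq_sequentially[symmetric] eventually_cofinite
    by simp
  also have "\<dots> \<longleftrightarrow> (\<forall>\<^sub>F n in sequentially. v (poly q (s n)) \<le> v (poly p (s n)))"
  proof (rule eventually_cong[OF eventually_poly_nonzero[OF assms(2,3)]])
    fix n assume "poly q (s n) \<noteq> 0"
    then show "(\<exists>y\<in>V. has_value_at (Fract p q) (s n) y) \<longleftrightarrow>
        v (poly q (s n)) \<le> v (poly p (s n))"
      by (simp add: has_value_at_Fract_iff V valuation_nonneg_divide_iff[OF val])
  qed
  finally show ?thesis .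
qed

section \<open>Bounds on radii tested by membership in a ring\<close>

lemma pseudo_limit_sequenceI:
  assumes "extends_valuation u v" "\<beta> \<in> pseudo_limits u s"
  shows "pseudo_limit_sequence u \<beta> (\<lambda>n. to_ac (s n))"
  using assms by unfold_locales (auto simp: extends_valuation_def pseudo_limits_def)

lemma inj_if_pseudo_limit:
  assumes "extends_valuation u v" "\<beta> \<in> pseudo_limits u s"
  shows "inj s"
  using pseudo_limit_sequence.inj_z[OF pseudo_limit_sequenceI[OF assms]]
  by (auto simp: inj_on_def)

text \<open>A Zariski test for a lower bound on the radii of \<open>s'\<close>. The ultrametric
  inequality, used in both directions, trades the value of \<open>s' n - a\<close> for the radius of
  \<open>s' n\<close>.\<close>

lemma linear_in_ring_of_sequence_iff:
  fixes u :: "'k::field alg_closure \<Rightarrow> 'g::linordered_ab_group_add extended"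
  assumes "associated_valuation V v" "extends_valuation u v" "\<beta> \<in> pseudo_limits u s'"
    and "d \<noteq> 0" "v d = u (\<beta> - to_ac a)"
  shows "Fract [:- a, 1:] [:d:] \<in> ring_of_sequence V s' \<longleftrightarrow>
    (\<forall>\<^sub>F n in sequentially. u (\<beta> - to_ac a) \<le> u (\<beta> - to_ac (s' n)))"
proof -
  have val: "valuation u" and ext: "\<And>x. v x = u (to_ac x)"
    using assms(2) by (auto simp: extends_valuation_def)
  have "u (\<beta> - to_ac a) \<le> u (to_ac (s' n) - to_ac a) \<longleftrightarrow>
      u (\<beta> - to_ac a) \<le> u (\<beta> - to_ac (s' n))" for n
    using valuation_diff[OF val, of "\<beta> - to_ac a" "\<beta> - to_ac (s' n)"]
      valuation_diff[OF val, of "\<beta> - to_ac a" "to_ac (s' n) - to_ac a"]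
    by (auto simp: min_def split: if_splits)
  then show ?thesis
    using Fract_in_ring_of_sequence_iff[OF assms(1) inj_if_pseudo_limit[OF assms(2,3)],
        of "[:d:]" "[:- a, 1:]"] assms(4,5)
    by (simp add: ext)
qed

text \<open>A Zariski test for an upper bound on radii: the constant \<open>e\<close> divided by the
  polynomial of \<open>radius_detecting_poly\<close>. It is chosen before the sequence, so one
  function serves all of them.\<close>

lemma radius_in_ring_of_sequence_iff:
  fixes u :: "'k::field alg_closure \<Rightarrow> 'g::linordered_ab_group_add extended"
  assumes "associated_valuation V v" "extends_valuation u v" "g \<noteq> 0"
  obtains \<psi> where "\<And>s. \<beta> \<in> pseudo_limits u s \<Longrightarrow>
    \<psi> \<in> ring_of_sequence V s \<longleftrightarrow> (\<forall>n. u (\<beta> - to_ac (s n)) < u g)"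
proof -
  have val: "valuation u" and ext: "\<And>x. v x = u (to_ac x)"
    using assms(2) by (auto simp: extends_valuation_def)
  obtain H e F where H: "H \<noteq> 0" and F: "finite F"
    and beyond: "\<And>x. u g < u (\<beta> - to_ac x) \<Longrightarrow> u (to_ac e) < u (to_ac (poly H x))"
    and upto: "\<And>x. u (\<beta> - to_ac x) \<le> u g \<Longrightarrow> u (\<beta> - to_ac x) \<notin> F \<Longrightarrow>
       u (to_ac (poly H x)) \<le> u (to_ac e)"
    using radius_detecting_poly[OF val assms(3), of \<beta>] by metis
  show thesis
  proof (rule that[of "Fract [:e:] H"])
    fix s :: "nat \<Rightarrow> 'k" assume s: "\<beta> \<in> pseudo_limits u s"
    interpret pseudo_limit_sequence u \<beta> "\<lambda>n. to_ac (s n)"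
      using assms(2) s by (rule pseudo_limit_sequenceI)
    have "Fract [:e:] H \<in> ring_of_sequence V s \<longleftrightarrow>
        (\<forall>\<^sub>F n in sequentially. u (to_ac (poly H (s n))) \<le> u (to_ac e))"
      using Fract_in_ring_of_sequence_iff[OF assms(1) inj_if_pseudo_limit[OF assms(2) s] H]
      by (simp add: ext)
    also have "\<dots> \<longleftrightarrow> (\<forall>n. u (\<beta> - to_ac (s n)) < u g)"
    proof
      assume ev: "\<forall>\<^sub>F n in sequentially. u (to_ac (poly H (s n))) \<le> u (to_ac e)"
      \<comment> \<open>One radius above \<open>u g\<close> would put all later ones above it, where
        \<open>H\<close> exceeds the critical value. Equality is excluded afterwards because the
        radii keep growing.\<close>
      have "u (\<beta> - to_ac (s n)) \<le> u g" for n
      proof (rule ccontr)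
        assume "\<not> u (\<beta> - to_ac (s n)) \<le> u g"
        then have "u (to_ac e) < u (to_ac (poly H (s m)))" if "m \<ge> n" for m
          using radius_le_iff[of n m] that by (intro beyond) simp
        then have "\<forall>\<^sub>F m in sequentially. u (to_ac e) < u (to_ac (poly H (s m)))"
          by (rule eventually_sequentiallyI)
        with ev have "\<forall>\<^sub>F m in sequentially. False"
          by eventually_elim simp
        then show False
          by simp
      qed
      then show "\<forall>n. u (\<beta> - to_ac (s n)) < u g"
        using radius_less_if_bounded by blast
    next
      assume "\<forall>n. u (\<beta> - to_ac (s n)) < u g"
      then show "\<forall>\<^sub>F n in sequentially. u (to_ac (poly H (s n))) \<le> u (to_ac e)"
        using eventually_radius_notin[OF F]
        by (auto elim!: eventually_mono intro: upto less_imp_le)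
    qed
    finally show "Fract [:e:] H \<in> ring_of_sequence V s \<longleftrightarrow> (\<forall>n. u (\<beta> - to_ac (s n)) < u g)" .
  qed
qed

text \<open>With \<open>\<phi> = p / q\<close>, membership of \<open>e / \<phi> ^ j\<close> makes
  \<open>j\<close> times the value of \<open>\<phi>\<close> along \<open>s'\<close> eventually at
  most \<open>v e < 0\<close>, so these values cannot be eventually nonnegative.\<close>

lemma separate_bounded_away:
  fixes u :: "'k::field alg_closure \<Rightarrow> 'g::linordered_ab_group_add extended"
  assumes "associated_valuation V v" "extends_valuation u v" "p \<noteq> 0" "q \<noteq> 0"
    and "v e < 0" "\<beta> \<in> pseudo_limits u s'"
    and "Fract (smult e (q ^ j)) (p ^ j) \<in> ring_of_sequence V s'"
  shows "Fract p q \<notin> ring_of_sequence V s'"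
proof
  have val: "valuation v"
    using assms(1) by (simp add: associated_valuation_def)
  have inj: "inj s'"
    using assms(2,6) by (rule inj_if_pseudo_limit)
  assume "Fract p q \<in> ring_of_sequence V s'"
  then have "\<forall>\<^sub>F n in sequentially. v (poly q (s' n)) \<le> v (poly p (s' n))"
    by (simp add: Fract_in_ring_of_sequence_iff[OF assms(1) inj assms(4)])
  moreover have "\<forall>\<^sub>F n in sequentially. v (poly p (s' n) ^ j) \<le> v (e * poly q (s' n) ^ j)"
    using assms(3,7) by (simp add: Fract_in_ring_of_sequence_iff[OF assms(1) inj])
  ultimately have "\<forall>\<^sub>F n in sequentially. False"
    using eventually_poly_nonzero[OF inj assms(4)]
  proof eventually_elim
    fix n
    assume *: "v (poly q (s' n)) \<le> v (poly p (s' n))"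
      "v (poly p (s' n) ^ j) \<le> v (e * poly q (s' n) ^ j)" "poly q (s' n) \<noteq> 0"
    have "v (poly q (s' n) ^ j * e) < v (poly q (s' n) ^ j * 1)"
      using assms(5) val *(3) by (intro valuation_mult_left_strict_mono) auto
    also have "\<dots> \<le> v (poly p (s' n) ^ j)"
      using valuation_power_mono[OF val *(1), of j] by simp
    finally show False
      using *(2) by (simp add: mult.commute)
  qed
  then show False
    by simp
qed

text \<open>The set \<open>\<Psi>\<close> describes a basic Zariski neighbourhood of the ring of
  \<open>s\<close>; none of the rings with pseudo-limit \<open>\<beta>\<close> in it contains
  \<open>\<phi>\<close>.\<close>

lemma separate_from_ring_of_sequence:
  fixes u :: "'k::field alg_closure \<Rightarrow> 'g::linordered_ab_group_add extended"
  assumes V: "associated_valuation V v" and u: "extends_valuation u v"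
    and s: "\<beta> \<in> pseudo_limits u s" and \<phi>: "\<phi> \<notin> ring_of_sequence V s"
  obtains \<Psi> where "finite \<Psi>" "\<Psi> \<subseteq> ring_of_sequence V s"
    "\<And>s'. \<beta> \<in> pseudo_limits u s' \<Longrightarrow> \<Psi> \<subseteq> ring_of_sequence V s' \<Longrightarrow> \<phi> \<notin> ring_of_sequence V s'"
proof -
  have val: "valuation u" and ext: "\<And>x. v x = u (to_ac x)"
    using u by (auto simp: extends_valuation_def)
  have val_v: "valuation v"
    using V by (simp add: associated_valuation_def)
  obtain p q where \<phi>_def: "\<phi> = Fract p q" and q: "q \<noteq> 0"
    by (cases \<phi>)
  have inj: "inj s"
    using u s by (rule inj_if_pseudo_limit)
  note in_ring = Fract_in_ring_of_sequence_iff[OF V]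
  have p: "p \<noteq> 0"
    using \<phi> val_v by (auto simp: \<phi>_def in_ring[OF inj q])
  interpret pseudo_limit_sequence u \<beta> "\<lambda>n. to_ac (s n)"
    using u s by (rule pseudo_limit_sequenceI)
  define r where "r n = \<beta> - to_ac (s n)" for n
  have r0: "r n \<noteq> 0" for n
    using z_neq_limit[of n] by (simp add: r_def)
  have poly_value: "\<exists>N d k. d \<noteq> 0 \<and>
      (\<forall>y. to_ac y \<in> annulus N \<longrightarrow> v (poly h y) = u (d * (\<beta> - to_ac y) ^ k))"
    if h: "h \<noteq> 0" for h :: "'k poly"
  proof -
    have "map_poly to_ac h \<noteq> 0"
      using h by simp
    from poly_root_multiset[OF this] obtain b A where b: "b \<noteq> 0"
      and A: "\<And>x. poly (map_poly to_ac h) x = b * (\<Prod>a\<in>#A. x - a)"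
      by blast
    obtain N d k where d: "d \<noteq> 0"
      "\<And>x. x \<in> annulus N \<Longrightarrow> u (poly (map_poly to_ac h) x) = u (d * (\<beta> - x) ^ k)"
      by (rule poly_value_on_annulus[OF A b]) blast
    have "v (poly h y) = u (d * (\<beta> - to_ac y) ^ k)" if "to_ac y \<in> annulus N" for y
      using d(2)[OF that] by (simp add: ext poly_map_poly_to_ac)
    then show ?thesis
      using d(1) by blast
  qed
  obtain N\<^sub>1 c k where c: "c \<noteq> 0"
    and "\<And>y. to_ac y \<in> annulus N\<^sub>1 \<Longrightarrow> v (poly p y) = u (c * (\<beta> - to_ac y) ^ k)"
    using poly_value[OF p] by blast
  moreover obtain N\<^sub>2 d l where d: "d \<noteq> 0"
    and "\<And>y. to_ac y \<in> annulus N\<^sub>2 \<Longrightarrow> v (poly q y) = u (d * (\<beta> - to_ac y) ^ l)"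
    using poly_value[OF q] by blast
  moreover define M where "M = max N\<^sub>1 N\<^sub>2"
  ultimately have vp: "v (poly p y) = u (c * (\<beta> - to_ac y) ^ k)"
    and vq: "v (poly q y) = u (d * (\<beta> - to_ac y) ^ l)" if "to_ac y \<in> annulus M" for y
    using that annulus_antimono[of N\<^sub>1 M] annulus_antimono[of N\<^sub>2 M] by auto
  have vp_s: "v (poly p (s n)) = u (c * r n ^ k)" and vq_s: "v (poly q (s n)) = u (d * r n ^ l)"
    if "n > M" for n
    using vp[of "s n"] vq[of "s n"] z_in_annulus[OF that] by (simp_all add: r_def)
  have frequently_negative: "\<exists>n\<ge>m. v (poly p (s n)) < v (poly q (s n))" for m
    using \<phi> by (auto simp: \<phi>_def in_ring[OF inj q] eventually_sequentially not_le)
  then obtain n\<^sub>0 where n\<^sub>0: "n\<^sub>0 > M" "v (poly p (s n\<^sub>0)) < v (poly q (s n\<^sub>0))"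
    using Suc_le_lessD by blast
  show thesis
  \<comment> \<open>In the first case the values of \<open>\<phi>\<close> along \<open>s\<close>
    eventually stay below a fixed negative bound. The exponent \<open>j\<close> admits bounds that
    are only fractions of values of the base field.\<close>
  proof (cases "\<exists>e j. j > 0 \<and> v e < 0 \<and>
      (\<forall>\<^sub>F n in sequentially. v (poly p (s n) ^ j) \<le> v (e * poly q (s n) ^ j))")
    case True
    then obtain e j where ej: "j > 0" "v e < 0"
      and "\<forall>\<^sub>F n in sequentially. v (poly p (s n) ^ j) \<le> v (e * poly q (s n) ^ j)"
      by blast
    then have "Fract (smult e (q ^ j)) (p ^ j) \<in> ring_of_sequence V s"
      using p by (simp add: in_ring[OF inj])
    then show thesis
      using separate_bounded_away[OF V u p q ej(2)]
      by (intro that[of "{Fract (smult e (q ^ j)) (p ^ j)}"]) (auto simp: \<phi>_def)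
  next
    case False
    \<comment> \<open>Were \<open>k \<le> l\<close>, the values of \<open>\<phi>\<close> along
      \<open>s\<close> could not increase with the radius, so the negative one at
      \<open>n\<^sub>0\<close> would remain an upper bound. That is the excluded case with
      \<open>j = 1\<close> and \<open>e\<close> the value taken by \<open>\<phi>\<close> at
      \<open>s n\<^sub>0\<close>.\<close>
    have "l < k"
    proof (rule ccontr)
      assume "\<not> l < k"
      then obtain i where l: "l = k + i"
        using le_Suc_ex not_less by blast
      define e where "e = poly p (s n\<^sub>0) / poly q (s n\<^sub>0)"
      have "poly q (s n\<^sub>0) \<noteq> 0"
        using vq_s[OF n\<^sub>0(1)] valuation_eq_Pinf_iff[OF val, of "d * r n\<^sub>0 ^ l"] d r0[of n\<^sub>0] val_v
        by auto
      then have e: "poly p (s n\<^sub>0) = e * poly q (s n\<^sub>0)"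
        and "v e < 0"
        using n\<^sub>0(2) valuation_nonneg_divide_iff[OF val_v, of "poly q (s n\<^sub>0)" "poly p (s n\<^sub>0)"]
        by (simp_all add: e_def not_le[symmetric])
      have "u (r n\<^sub>0 ^ k * c) = v e + u (d * r n\<^sub>0 ^ l)"
        using vp_s[OF n\<^sub>0(1)] vq_s[OF n\<^sub>0(1)] e valuation_mult[OF val_v, of e "poly q (s n\<^sub>0)"]
        by (simp add: mult.commute)
      also have "\<dots> = u (r n\<^sub>0 ^ k * (to_ac e * d * r n\<^sub>0 ^ i))"
        by (simp add: ext l power_add valuation_mult[OF val] ac_simps)
      finally have "u c \<le> u (to_ac e * d * r n\<^sub>0 ^ i)"
        using valuation_mult_le_cancel[OF val, of "r n\<^sub>0 ^ k" c "to_ac e * d * r n\<^sub>0 ^ i"] r0[of n\<^sub>0]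
        by simp
      have "v (poly p (s n) ^ 1) \<le> v (e * poly q (s n) ^ 1)" if "n > n\<^sub>0" for n
      proof -
        have "u (r n\<^sub>0) \<le> u (r n)"
          using that by (simp add: r_def radius_le_iff)
        have "u c \<le> u (to_ac e * d * r n ^ i)"
          using \<open>u c \<le> _\<close> valuation_mult_left_mono[OF val
              valuation_power_mono[OF val \<open>u (r n\<^sub>0) \<le> u (r n)\<close>]]
          by (rule order_trans)
        then have "u (r n ^ k * c) \<le> u (r n ^ k * (to_ac e * d * r n ^ i))"
          by (rule valuation_mult_left_mono[OF val])
        also have "\<dots> = v e + u (d * r n ^ l)"
          by (simp add: ext l power_add valuation_mult[OF val] ac_simps)
        finally show ?thesis
          using vp_s[of n] vq_s[of n] that n\<^sub>0(1) valuation_mult[OF val_v, of e "poly q (s n)"]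
          by (simp add: mult.commute)
      qed
      then have "\<forall>\<^sub>F n in sequentially. v (poly p (s n) ^ 1) \<le> v (e * poly q (s n) ^ 1)"
        using eventually_gt_at_top[of n\<^sub>0] by (rule eventually_mono[rotated])
      then show False
        using False \<open>v e < 0\<close> zero_less_one by blast
    qed
    then obtain i where k: "k = l + i" and i: "i > 0"
      using less_imp_add_positive by blast
    \<comment> \<open>On the annulus \<open>\<phi>\<close> has the value of
      \<open>(b * x) ^ i\<close> with \<open>x\<close> the difference to \<open>\<beta>\<close>.
      This value changes sign at the radius of \<open>g = inverse b\<close>.\<close>
    obtain b where b: "b ^ i = c / d"
      using nth_root_exists[OF i] by blast
    have "b \<noteq> 0"
      using b c d i by (auto simp: power_0_left)
    define g where "g = inverse b"
    have "g \<noteq> 0"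
      using \<open>b \<noteq> 0\<close> by (simp add: g_def)
    have less_iff: "u (c * x ^ k) < u (d * x ^ l) \<longleftrightarrow> u x < u g" if "x \<noteq> 0" for x
    proof -
      have "c * x ^ k = (d * x ^ l) * (b * x) ^ i"
        using d by (simp add: b k power_add power_mult_distrib field_simps)
      then have "u (c * x ^ k) < u (d * x ^ l) \<longleftrightarrow> u ((b * x) ^ i) < u (1 ^ i)"
        using valuation_mult_less_cancel[OF val, of "d * x ^ l" "(b * x) ^ i" 1] that d by simp
      also have "\<dots> \<longleftrightarrow> u (b * x) < u (b * g)"
        using valuation_power_less_cancel[OF val i, of "b * x" 1] \<open>b \<noteq> 0\<close> by (simp add: g_def)
      also have "\<dots> \<longleftrightarrow> u x < u g"
        by (rule valuation_mult_less_cancel[OF val \<open>b \<noteq> 0\<close>])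
      finally show ?thesis .
    qed
    \<comment> \<open>Since the values of \<open>\<phi>\<close> along \<open>s\<close> approach \<open>0\<close>, the radii of \<open>s\<close> approach \<open>u g\<close>,
      so that the value formula holds for all radii between \<open>u (r M)\<close> and \<open>u g\<close>.\<close>
    have in_annulus: "\<exists>m. u x < u (r m)" if x: "u x < u g" for x
    proof (cases "x = 0")
      case False': False
      have "u (b * x) < u (b * g)"
        using x \<open>b \<noteq> 0\<close> by (simp add: valuation_mult_less_cancel[OF val])
      then have "u ((b * x) ^ i) < 0"
        using valuation_power_strict_mono[OF val _ i, of "b * x" 1] \<open>b \<noteq> 0\<close> val
        by (simp add: g_def)
      moreover have "(b * x) ^ i \<noteq> 0"
        using \<open>b \<noteq> 0\<close> False' by simp
      then obtain j e where j: "j > 0" and e: "u (((b * x) ^ i) ^ j) = u (to_ac e)"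
        using extension_value_torsion[OF val] by blast
      ultimately have "v e < 0"
        using valuation_power_strict_mono[OF val _ j, of "(b * x) ^ i" 1] val by (simp add: ext)
      \<comment> \<open>The negated case is applied to the negative value of
        \<open>(b * x) ^ i\<close>, made attainable in the base field by the power \<open>j\<close>.
        At some \<open>s n\<close> the value of \<open>\<phi>\<close> exceeds it, so the radius of
        \<open>s n\<close> exceeds \<open>u x\<close>.\<close>
      then have "\<not> (\<forall>\<^sub>F n in sequentially. v (poly p (s n) ^ j) \<le> v (e * poly q (s n) ^ j))"
        using False j by blast
      then obtain n where n: "n > M" "v (e * poly q (s n) ^ j) < v (poly p (s n) ^ j)"
        using Suc_le_lessD unfolding eventually_sequentially not_le[symmetric] by blast
      have "u (((b * x) ^ i * to_ac (poly q (s n))) ^ j) < u (to_ac (poly p (s n)) ^ j)"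
        using n(2) e by (simp add: ext power_mult_distrib[of _ _ j] valuation_mult[OF val])
      then have "u ((b * x) ^ i * to_ac (poly q (s n))) < u (to_ac (poly p (s n)))"
        by (simp add: valuation_power_less_cancel[OF val j])
      then have "u ((b * x) ^ i * (d * r n ^ l)) < u (c * r n ^ k)"
        using vp_s[OF n(1)] vq_s[OF n(1)] by (simp add: ext valuation_mult[OF val])
      also have "c * r n ^ k = (d * r n ^ l) * (b * r n) ^ i"
        using d by (simp add: b k power_add power_mult_distrib field_simps)
      finally have "u ((d * r n ^ l) * (b * x) ^ i) < u ((d * r n ^ l) * (b * r n) ^ i)"
        by (simp add: mult.commute)
      then show ?thesis
        using r0[of n] d \<open>b \<noteq> 0\<close>
        by (auto simp: valuation_mult_less_cancel[OF val] valuation_power_less_cancel[OF val i])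
    qed (use x val in simp)
    \<comment> \<open>Some later member gives \<open>\<phi>\<close> a negative value, hence has
      radius below \<open>u g\<close>, and radii increase.\<close>
    have below: "u (r n) < u g" for n
    proof -
      obtain m where m: "m \<ge> max (Suc M) n" "v (poly p (s m)) < v (poly q (s m))"
        using frequently_negative by blast
      then have "u (r m) < u g"
        using vp_s[of m] vq_s[of m] less_iff[OF r0[of m]] by simp
      moreover have "u (r n) \<le> u (r m)"
        using m(1) by (simp add: r_def radius_le_iff)
      ultimately show ?thesis
        by simp
    qed
    \<comment> \<open>By \<open>value_diff_z\<close> the denominator has value
      \<open>u (r M)\<close>, so this function tests the lower bound \<open>u (r M)\<close>.\<close>
    define \<psi>\<^sub>1 where "\<psi>\<^sub>1 = Fract [:- s M, 1:] [:s (Suc M) - s M:]"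
    have \<psi>\<^sub>1: "\<psi>\<^sub>1 \<in> ring_of_sequence V s' \<longleftrightarrow>
        (\<forall>\<^sub>F n in sequentially. u (r M) \<le> u (\<beta> - to_ac (s' n)))"
      if "\<beta> \<in> pseudo_limits u s'" for s'
      unfolding \<psi>\<^sub>1_def r_def
      by (rule linear_in_ring_of_sequence_iff[OF V u that])
        (use injD[OF inj, of "Suc M" M] value_diff_z[of M "Suc M"] in \<open>auto simp: ext\<close>)
    obtain \<psi>\<^sub>2 where \<psi>\<^sub>2: "\<And>s'. \<beta> \<in> pseudo_limits u s' \<Longrightarrow>
        \<psi>\<^sub>2 \<in> ring_of_sequence V s' \<longleftrightarrow> (\<forall>n. u (\<beta> - to_ac (s' n)) < u g)"
      using radius_in_ring_of_sequence_iff[OF V u \<open>g \<noteq> 0\<close>] by blast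
    show thesis
    proof (rule that[of "{\<psi>\<^sub>1, \<psi>\<^sub>2}"])
      have "\<psi>\<^sub>1 \<in> ring_of_sequence V s"
        unfolding \<psi>\<^sub>1[OF s] r_def radius_le_iff by (rule eventually_ge_at_top)
      moreover have "\<psi>\<^sub>2 \<in> ring_of_sequence V s"
        unfolding \<psi>\<^sub>2[OF s] using below by (simp add: r_def)
      ultimately show "{\<psi>\<^sub>1, \<psi>\<^sub>2} \<subseteq> ring_of_sequence V s"
        by simp
    next
      fix s' assume s': "\<beta> \<in> pseudo_limits u s'" and sub: "{\<psi>\<^sub>1, \<psi>\<^sub>2} \<subseteq> ring_of_sequence V s'"
      interpret s': pseudo_limit_sequence u \<beta> "\<lambda>n. to_ac (s' n)"
        using u s' by (rule pseudo_limit_sequenceI)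
      have upper: "u (\<beta> - to_ac (s' n)) < u g" for n
        using \<psi>\<^sub>2[OF s'] sub by simp
      \<comment> \<open>The test gives a weak inequality, while the annulus asks for a strict one;
        the growth of the radii of \<open>s'\<close> closes the gap.\<close>
      have "\<forall>\<^sub>F n in sequentially. u (r M) < u (\<beta> - to_ac (s' n))"
        by (rule s'.radius_ge_eventually_greater) (use \<psi>\<^sub>1[OF s'] sub in simp)
      then have "\<forall>\<^sub>F n in sequentially. v (poly p (s' n)) < v (poly q (s' n))"
      proof eventually_elim
        fix n assume "u (r M) < u (\<beta> - to_ac (s' n))"
        then have "to_ac (s' n) \<in> annulus M"
          using in_annulus[OF upper[of n]] by (auto simp: annulus_def r_def)
        then show "v (poly p (s' n)) < v (poly q (s' n))"
          using less_iff[of "\<beta> - to_ac (s' n)"] upper[of n] s'.z_neq_limit[of n]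
          by (simp add: vp vq)
      qed
      moreover have False
        if "\<forall>\<^sub>F n in sequentially. v (poly p (s' n)) < v (poly q (s' n))"
          "\<forall>\<^sub>F n in sequentially. v (poly q (s' n)) \<le> v (poly p (s' n))"
        using eventually_happens[OF eventually_conj[OF that]] by auto
      ultimately show "\<phi> \<notin> ring_of_sequence V s'"
        unfolding \<phi>_def in_ring[OF inj_if_pseudo_limit[OF u s'] q] by blast
    qed simp
  qed
qed


section \<open>Comparing the topologies\<close>

text \<open>Intersecting with \<open>R\<close> commutes with finite intersections and with unions,
  so openness of traces passes from the generators to all open sets.\<close>

lemma openin_subtopology_topology_generated_by:
  assumes "openin (topology_generated_by \<S>) A"
    and "\<And>S. S \<in> \<S> \<Longrightarrow> openin (subtopology T R) (S \<inter> R)"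
  shows "openin (subtopology T R) (A \<inter> R)"
proof -
  have "generate_topology_on \<S> A"
    using assms(1) by (rule openin_topology_generated_by)
  then show ?thesis
  proof (induction rule: generate_topology_on.induct)
    case (Int A B)
    then have "openin (subtopology T R) ((A \<inter> R) \<inter> (B \<inter> R))"
      by (intro openin_Int[of _ "A \<inter> R" "B \<inter> R"])
    then show ?case
      by (simp add: Int_ac)
  next
    case (UN \<K>)
    then show ?case
      unfolding Int_Union2 by (intro openin_Union) auto
  qed (use assms(2) in auto)
qed

lemma subtopology_topology_generated_by_eqI:
  assumes "\<And>S. S \<in> \<S> \<Longrightarrow> openin (subtopology (topology_generated_by \<T>) R) (S \<inter> R)"
    and "\<And>T. T \<in> \<T> \<Longrightarrow> openin (subtopology (topology_generated_by \<S>) R) (T \<inter> R)"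
  shows "subtopology (topology_generated_by \<S>) R = subtopology (topology_generated_by \<T>) R"
proof -
  have "openin (subtopology (topology_generated_by \<S>) R) U \<longleftrightarrow>
      openin (subtopology (topology_generated_by \<T>) R) U" for U
    using openin_subtopology_topology_generated_by[OF _ assms(1)]
      openin_subtopology_topology_generated_by[OF _ assms(2)]
    by (metis openin_subtopology)
  then show ?thesis
    by (simp add: topology_eq)
qed

theorem proposition4p6:
  fixes V :: "'k::field set"
    and v :: "'k \<Rightarrow> 'g::linordered_ab_group_add extended"
    and u :: "'k alg_closure \<Rightarrow> 'g extended"
    and \<beta> :: "'k alg_closure"
  assumes "valuation_domain V"
    and "valuation_rank V = 1"
    and "associated_valuation V v"
    and "extends_valuation u v"
  shows "subtopology (zariski_topology V) (rings_with_pseudo_limit V v u \<beta>) =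
         subtopology (constructible_topology V) (rings_with_pseudo_limit V v u \<beta>)"
proof -
  let ?R = "rings_with_pseudo_limit V v u \<beta>"
  let ?Z = "subtopology (zariski_topology V) ?R"
  have open_basic: "openin (zariski_topology V) (\<Inter>\<phi>\<in>\<Phi>. basic_open V \<phi>)"
    if "finite \<Phi>" "\<Phi> \<noteq> {}" for \<Phi>
    using that unfolding zariski_topology_def
    by (intro openin_INT2) (auto intro: topology_generated_by_Basis)
  \<comment> \<open>The separation result makes each complement of a basic set a neighbourhood of
    each of its points within \<open>?R\<close>.\<close>
  have open_compl: "openin ?Z ((Zar V - basic_open V \<phi>) \<inter> ?R)" for \<phi>
  proof (subst openin_subopen, intro ballI)
    fix W assume W: "W \<in> (Zar V - basic_open V \<phi>) \<inter> ?R"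
    then obtain s where W_eq: "W = ring_of_sequence V s" and s: "\<beta> \<in> pseudo_limits u s"
      and "W \<in> Zar V" and \<phi>: "\<phi> \<notin> ring_of_sequence V s"
      by (auto simp: rings_with_pseudo_limit_def basic_open_def)
    obtain \<Psi> where \<Psi>: "finite \<Psi>" "\<Psi> \<subseteq> W"
      and sep: "\<And>s'. \<beta> \<in> pseudo_limits u s' \<Longrightarrow> \<Psi> \<subseteq> ring_of_sequence V s' \<Longrightarrow>
        \<phi> \<notin> ring_of_sequence V s'"
      using separate_from_ring_of_sequence[OF assms(3,4) s \<phi>] unfolding W_eq by blast
    \<comment> \<open>Every valuation domain contains 0, so inserting it changes no condition. It
      keeps the index set nonempty, and hence \<open>?U\<close> inside \<open>Zar V\<close>, even if
      \<open>\<Psi>\<close> is empty.\<close>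
    let ?U = "\<Inter>\<psi>\<in>insert 0 \<Psi>. basic_open V \<psi>"
    have "W \<in> ?U"
      using \<Psi>(2) \<open>W \<in> Zar V\<close> by (auto simp: basic_open_def Zar_def valuation_domain_def)
    moreover have "?U \<inter> ?R \<subseteq> (Zar V - basic_open V \<phi>) \<inter> ?R"
      using sep by (fastforce simp: basic_open_def rings_with_pseudo_limit_def)
    moreover have "openin ?Z (?U \<inter> ?R)"
      using open_basic[of "insert 0 \<Psi>"] \<Psi>(1) by (auto simp: openin_subtopology)
    ultimately show "\<exists>T. openin ?Z T \<and> W \<in> T \<and> T \<subseteq> (Zar V - basic_open V \<phi>) \<inter> ?R"
      using W by blast
  qed
  show ?thesis
    unfolding zariski_topology_def constructible_topology_def
  proof (rule subtopology_topology_generated_by_eqI, fold zariski_topology_def constructible_topology_def)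
    fix S assume "S \<in> range (basic_open V)"
    then obtain \<phi> where "S = (\<Inter>\<phi>\<in>{\<phi>}. basic_open V \<phi>)"
      by auto
    then have "openin (constructible_topology V) S"
      unfolding constructible_topology_def
      by (intro topology_generated_by_Basis UN_I[of "{\<phi>}"]) auto
    then show "openin (subtopology (constructible_topology V) ?R) (S \<inter> ?R)"
      by (auto simp: openin_subtopology)
  next
    fix T assume "T \<in> (\<Union>\<Phi>\<in>{\<Phi>. finite \<Phi> \<and> \<Phi> \<noteq> {}}.
      {\<Inter>\<phi>\<in>\<Phi>. basic_open V \<phi>, Zar V - (\<Inter>\<phi>\<in>\<Phi>. basic_open V \<phi>)})"
    then obtain \<Phi> where \<Phi>: "finite \<Phi>" "\<Phi> \<noteq> {}"
      and "T = (\<Inter>\<phi>\<in>\<Phi>. basic_open V \<phi>) \<or> T = Zar V - (\<Inter>\<phi>\<in>\<Phi>. basic_open V \<phi>)"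
      by blast
    \<comment> \<open>De Morgan reduces the complement of an intersection to the complements of
      single basic sets.\<close>
    then consider "T = (\<Inter>\<phi>\<in>\<Phi>. basic_open V \<phi>)"
      | "T \<inter> ?R = (\<Union>\<phi>\<in>\<Phi>. (Zar V - basic_open V \<phi>) \<inter> ?R)"
      by blast
    then show "openin ?Z (T \<inter> ?R)"
    proof cases
      case 1
      then show ?thesis
        using open_basic[OF \<Phi>] by (auto simp: openin_subtopology)
    next
      case 2
      show ?thesis
        unfolding 2 using open_compl by (intro openin_Union) blast
    qed
  qed
qed

end
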